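(* Let $n\ge3$. Let $\{\mathcal{G}_N\}$ be a family of undirected weighted graphs of increasing size $N$ ($N\to\infty$) with bounded neighborhoods ($|\mathcal{N}_i|\le q$ for all $i\in\mathcal{V}_N$, with $q$ fixed and independent of $N$) and finite weights ($w_{ij}\le w_{\max}<\infty$ for all $(i,j)\in\mathcal{E}_N$, with $w_{\max}$ fixed and independent of $N$). Then no leader-follower consensus algorithm of order $n$, i.e. with closed-loop dynamics $$\frac{d}{dt}\bar\xi=\begin{bmatrix}0&I_{N-1}&0&\cdots&0\\0&0&I_{N-1}&\cdots&0\\ \vdots& & &\ddots&\vdots\\0&0&0&\cdots&I_{N-1}\\-a_0\bar L&-a_1\bar L&-a_2\bar L&\cdots&-a_{n-1}\bar L\end{bmatrix}\bar\xi ,$$ with gains $a_k>0$, $k=0,\dots,n-1$, that are finite and fixed (independent of $N$ and of the graph within the family), is scalably stable in $\{\mathcal{G}_N\}$. That is, for every such choice of gains there is a graph in the family over which the closed-loop system does not achieve consensus.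
   Context: Graphs: $\mathcal{G}_N=\{\mathcal{V}_N,\mathcal{E}_N\}$ has $N$ nodes and nonnegative edge weights $w_{ij}$ ($w_{ij}=0$ if $(i,j)\notin\mathcal{E}_N$); undirected means $(i,j)\in\mathcal{E}_N\Rightarrow(j,i)\in\mathcal{E}_N$ and $w_{ij}=w_{ji}$. The neighbor set is $\mathcal{N}_i=\{j:(i,j)\in\mathcal{E}_N\}$. The Laplacian $L$ has $[L]_{ij}=-w_{ij}$ if $j\ne i$, $j\in\mathcal{N}_i$, $[L]_{ii}=\sum_{k\in\mathcal{N}_i}w_{ik}$, and $0$ otherwise. The grounded Laplacian $\bar L$ is obtained from $L$ by deleting its first row and column. A graph family is a sequence of graphs in which $N$ is increasing; $\mathcal{G}_N$ need not be a subgraph of $\mathcal{G}_{N+1}$. Leader-follower dynamics: each agent $i$ has a scalar state $x_i$ with $x_i^{(k)}$ its $k$-th time derivative, obeying $x_i^{(n)}=u_i$ with $u_i=-\sum_{k=0}^{n-1}a_k\sum_{j\in\mathcal{N}_i}w_{ij}(x_i^{(k)}-x_j^{(k)})$ for $i=2,\dots,N$, while Agent 1 is the leader, with $x_1=\dot x_1=\dots=x_1^{(n)}\equiv0$. The vector $\bar\xi\in\mathbb{R}^{(N-1)n}$ stacks $(x_2^{(k)},\dots,x_N^{(k)})$ for $k=0,1,\dots,n-1$. Consensus: $x_i^{(k)}(t)-x_j^{(k)}(t)\to0$ as $t\to\infty$ for all $i,j\in\mathcal{V}_N$, all $k=0,\dots,n-1$, and any initial state; since the leader's state is identically zero, this means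 $\bar\xi(t)\to0$ for any $\bar\xi(0)$. A control design is scalably stable in a family if the closed-loop system achieves consensus over every graph in the family. *)

theory Defs
  imports Complex_Main "Jordan_Normal_Form.Determinant"
begin

text \<open>Nodes are numbered from \<open>0\<close>, to agree with the indexing of matrices: a graph on \<open>N\<close> nodes
  has node set \<open>{..<N}\<close>, and the leader (Agent 1 of the usual numbering) is node \<open>0\<close>.\<close>

record weighted_graph =
  num_nodes :: nat
  edges :: "(nat \<times> nat) set"
  weight :: "nat \<Rightarrow> nat \<Rightarrow> real"

text \<open>Self-loops are excluded. They do not influence the agents' dynamics, but a self-loop would
  enter the diagonal of the Laplacian below, which would then no longer have zero row sums.\<close>

definition is_weighted_graph :: "weighted_graph \<Rightarrow> bool" where
  "is_weighted_graph G \<longleftrightarrow>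
     num_nodes G \<ge> 1 \<and>
     edges G \<subseteq> {..<num_nodes G} \<times> {..<num_nodes G} \<and>
     (\<forall>i. (i, i) \<notin> edges G) \<and>
     (\<forall>i j. weight G i j \<ge> 0) \<and>
     (\<forall>i j. (i, j) \<notin> edges G \<longrightarrow> weight G i j = 0)"

definition undirected :: "weighted_graph \<Rightarrow> bool" where
  "undirected G \<longleftrightarrow>
     (\<forall>i j. (i, j) \<in> edges G \<longrightarrow> (j, i) \<in> edges G \<and> weight G i j = weight G j i)"

definition neighbors :: "weighted_graph \<Rightarrow> nat \<Rightarrow> nat set" where
  "neighbors G i = {j. (i, j) \<in> edges G}"

definition laplacian :: "weighted_graph \<Rightarrow> real mat" where
  "laplacian G = mat (num_nodes G) (num_nodes G)
     (\<lambda>(i, j). if i = j then (\<Sum>k\<in>neighbors G i. weight G i k)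
               else if j \<in> neighbors G i then - weight G i j
               else 0)"

definition grounded_laplacian :: "weighted_graph \<Rightarrow> real mat" where
  "grounded_laplacian G = mat_delete (laplacian G) 0 0"

text \<open>The closed-loop matrix has \<open>n \<times> n\<close> blocks of size \<open>m = N - 1\<close>; entry \<open>(r, c)\<close> is entry
  \<open>(r mod m, c mod m)\<close> of block \<open>(r div m, c div m)\<close>.\<close>

definition closed_loop_matrix :: "nat \<Rightarrow> (nat \<Rightarrow> real) \<Rightarrow> weighted_graph \<Rightarrow> real mat" where
  "closed_loop_matrix n a G =
     (let m = num_nodes G - 1 in
      mat (n * m) (n * m)
        (\<lambda>(r, c).
           if r div m < n - 1
           then (if c div m = r div m + 1 then 1\<^sub>m m $$ (r mod m, c mod m) else 0)
           else - a (c div m) * grounded_laplacian G $$ (r mod m, c mod m)))"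

definition closed_loop_solution ::
    "nat \<Rightarrow> (nat \<Rightarrow> real) \<Rightarrow> weighted_graph \<Rightarrow> (real \<Rightarrow> real vec) \<Rightarrow> bool" where
  "closed_loop_solution n a G \<xi> \<longleftrightarrow>
     (\<forall>t\<ge>0. \<xi> t \<in> carrier_vec (n * (num_nodes G - 1)) \<and>
       (\<forall>r < n * (num_nodes G - 1).
          ((\<lambda>s. \<xi> s $ r) has_real_derivative (closed_loop_matrix n a G *\<^sub>v \<xi> t) $ r)
            (at t within {0..})))"

text \<open>The \<open>k\<close>-th derivative of the state of node \<open>i\<close>, read off from the stacked follower state;
  the leader's state is identically zero.\<close>

definition agent_state :: "weighted_graph \<Rightarrow> (real \<Rightarrow> real vec) \<Rightarrow> nat \<Rightarrow> nat \<Rightarrow> real \<Rightarrow> real" where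
  "agent_state G \<xi> k i t =
     (if i = 0 then 0 else \<xi> t $ (k * (num_nodes G - 1) + (i - 1)))"

text \<open>Every initial state is covered, since \<open>\<xi>\<close> ranges over all solutions, with \<open>\<xi> 0\<close> unrestricted.\<close>

definition achieves_consensus :: "nat \<Rightarrow> (nat \<Rightarrow> real) \<Rightarrow> weighted_graph \<Rightarrow> bool" where
  "achieves_consensus n a G \<longleftrightarrow>
     (\<forall>\<xi>. closed_loop_solution n a G \<xi> \<longrightarrow>
       (\<forall>i < num_nodes G. \<forall>j < num_nodes G. \<forall>k < n.
          ((\<lambda>t. agent_state G \<xi> k i t - agent_state G \<xi> k j t) \<longlongrightarrow> 0) at_top))"

text \<open>A family is a sequence of graphs with strictly increasing, hence unbounded, number of nodes;
  not every size need occur.\<close>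

definition graph_family :: "(nat \<Rightarrow> weighted_graph) \<Rightarrow> bool" where
  "graph_family \<G> \<longleftrightarrow> (\<forall>m. is_weighted_graph (\<G> m)) \<and> strict_mono (\<lambda>m. num_nodes (\<G> m))"

definition scalably_stable :: "nat \<Rightarrow> (nat \<Rightarrow> real) \<Rightarrow> (nat \<Rightarrow> weighted_graph) \<Rightarrow> bool" where
  "scalably_stable n a \<G> \<longleftrightarrow> (\<forall>m. achieves_consensus n a (\<G> m))"

end

theory Submission
  imports Defs "HOL-Analysis.Function_Topology"
    "HOL-Computational_Algebra.Fundamental_Theorem_Algebra"
begin

text \<open>Along an eigenvector \<open>v\<close> of the grounded Laplacian with eigenvalue \<open>\<mu>\<close>, the closed loop
  reduces to the scalar equation with characteristic polynomial
  \<open>s\<^sup>n + \<mu> (a\<^sub>n\<^sub>-\<^sub>1 s\<^sup>n\<^sup>-\<^sup>1 + \<dots> + a\<^sub>0)\<close>, so consensus forces all roots of this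
  polynomial into the open left half-plane. Large graphs with bounded neighborhoods and weights
  have an eigenvalue below any given positive bound, and for small \<open>\<mu>\<close> the polynomial has a
  root in the closed right half-plane as soon as \<open>n \<ge> 3\<close>.

  Small eigenvalues: the grounded Laplacian is symmetric, so its least eigenvalue is the minimum
  of the Rayleigh quotient (\<open>symmetric_matrix_min_eigenpair\<close>). At the all-ones vector this
  quotient is the total weight at the leader divided by \<open>N - 1\<close>, because every row of the full
  Laplacian sums to zero (\<open>grounded_laplacian_sum_le_leader_degree\<close>).

  Unstable roots: heuristically, the roots for small \<open>\<mu>\<close> are close to the \<open>n\<close>-th roots of
  \<open>- \<mu> a\<^sub>0\<close>, which are spread evenly over a circle, so that at least one of them has
  positive real part if \<open>n \<ge> 3\<close>. The rigorous argument avoids perturbation theory. If all roots \<open>r\<^sub>i\<close> had negative real part, the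
  numbers \<open>- Re r\<^sub>i\<close> would be positive with sum \<open>\<mu> a\<^sub>n\<^sub>-\<^sub>1\<close>, and the power sum
  \<open>\<Sum> r\<^sub>i\<^sup>2 = \<mu>\<^sup>2 a\<^sub>n\<^sub>-\<^sub>1\<^sup>2 - 2 \<mu> a\<^sub>n\<^sub>-\<^sub>2\<close> would then control the imaginary parts too:
  every \<open>r\<^sub>i\<close> would have modulus of order at most \<open>\<mu>\<^sup>1\<^sup>/\<^sup>2\<close>. The product of the moduli is
  \<open>\<mu> a\<^sub>0\<close>, so \<open>\<mu> a\<^sub>0\<close> would be of order at most \<open>\<mu>\<^sup>n\<^sup>/\<^sup>2\<close>, which is impossible for small
  \<open>\<mu>\<close> if \<open>n \<ge> 3\<close> (\<open>hurwitz_constant_coeff_bound\<close>, \<open>unstable_root_for_small_gain\<close>).\<close>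

section \<open>Roots of a monic polynomial in the open left half-plane\<close>

lemma
  fixes r :: "nat \<Rightarrow> complex"
  shows degree_prod_linear_factors: "degree (\<Prod>i<d. [:- r i, 1:]) = d"
    and lead_coeff_prod_linear_factors: "coeff (\<Prod>i<d. [:- r i, 1:]) d = 1"
    and subleading_coeff_prod_linear_factors:
      "coeff (\<Prod>i<Suc d. [:- r i, 1:]) d = - (\<Sum>i<Suc d. r i)"
    and third_coeff_prod_linear_factors:
      "2 * coeff (\<Prod>i<Suc (Suc d). [:- r i, 1:]) d
        = (\<Sum>i<Suc (Suc d). r i)\<^sup>2 - (\<Sum>i<Suc (Suc d). (r i)\<^sup>2)"
proof -
  let ?P = "\<lambda>d. \<Prod>i<d. [:- r i, 1:]"
  have step: "coeff (?P (Suc d)) (Suc k) = coeff (?P d) k - r d * coeff (?P d) (Suc k)" for d k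
    by (simp add: mult.commute[of "?P d"])
  show deg: "degree (?P d) = d" for d
    by (subst degree_prod_sum_eq) auto
  show lead: "coeff (?P d) d = 1" for d
  proof (induction d)
    case (Suc d)
    have "coeff (?P d) (Suc d) = 0" by (rule coeff_eq_0) (simp add: deg)
    with Suc show ?case by (simp only: step) simp
  qed simp
  have sub: "coeff (?P (Suc d)) d = - (\<Sum>i<Suc d. r i)" for d
  proof (induction d)
    case (Suc d)
    show ?case by (simp only: step Suc lead) simp
  qed simp
  then show "coeff (?P (Suc d)) d = - (\<Sum>i<Suc d. r i)" .
  show "2 * coeff (?P (Suc (Suc d))) d = (\<Sum>i<Suc (Suc d). r i)\<^sup>2 - (\<Sum>i<Suc (Suc d). (r i)\<^sup>2)"
  proof (induction d)
    case 0
    show ?case by (simp add: power2_eq_square algebra_simps)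
  next
    case (Suc d)
    show ?case
      by (simp only: step[of "Suc (Suc d)" d] sub right_diff_distrib Suc)
        (simp add: power2_eq_square algebra_simps)
  qed
qed

text \<open>When all roots are in the left half-plane, the negated real parts are positive, hence the sum
  of their squares is at most the square of their sum, \<open>e\<^sub>1\<^sup>2\<close>, where
  \<open>e\<^sub>k\<close> is the elementary symmetric polynomial in the negated roots, which is the \<open>k\<close>-th
  coefficient of \<open>p\<close> from the top. Newton's identity
  \<open>\<Sum> r\<^sub>i\<^sup>2 = e\<^sub>1\<^sup>2 - 2 e\<^sub>2\<close> has real part \<open>\<Sum> (Re r\<^sub>i)\<^sup>2 - \<Sum> (Im r\<^sub>i)\<^sup>2\<close>, which
  turns this into \<open>\<Sum> \<bar>r\<^sub>i\<bar>\<^sup>2 \<le> e\<^sub>1\<^sup>2 + 2 e\<^sub>2 = R\<close>. So each factor of the constant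
  coefficient \<open>\<plusminus> \<Prod> r\<^sub>i\<close> has squared modulus at most \<open>R\<close>.\<close>

lemma
  fixes p :: "complex poly"
  assumes deg: "degree p = n" and n: "n \<ge> 2" and monic: "lead_coeff p = 1"
    and hurwitz: "\<And>s. poly p s = 0 \<Longrightarrow> Re s < 0"
    and real: "Im (coeff p (n - 1)) = 0"
  defines "R \<equiv> (Re (coeff p (n - 1)))\<^sup>2 + 2 * Re (coeff p (n - 2))"
  shows hurwitz_subleading_pos: "0 < Re (coeff p (n - 1))"
    and hurwitz_constant_coeff_bound: "(cmod (coeff p 0))\<^sup>2 \<le> R ^ n"
proof -
  obtain r where "smult (lead_coeff p) (\<Prod>i<degree p. [:-r i, 1:]) = p"
    by (rule complex_poly_decompose')
  with deg monic have p: "p = (\<Prod>i<n. [:- r i, 1:])" by simp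
  obtain d where d: "n = Suc (Suc d)" using n by (metis Suc_le_D numeral_2_eq_2 Suc_le_mono)
  have neg: "Re (r i) < 0" if "i < n" for i
    using that by (intro hurwitz) (auto simp: p poly_prod)
  have c1: "coeff p (n - 1) = - (\<Sum>i<n. r i)"
    using subleading_coeff_prod_linear_factors[of r "Suc d"] by (simp add: p d)
  have c2: "2 * coeff p (n - 2) = (\<Sum>i<n. r i)\<^sup>2 - (\<Sum>i<n. (r i)\<^sup>2)"
    using third_coeff_prod_linear_factors[of r d] by (simp add: p d)
  have e1: "Re (coeff p (n - 1)) = (\<Sum>i<n. - Re (r i))"
    unfolding c1 by (simp add: sum_negf)
  show "0 < Re (coeff p (n - 1))"
    unfolding e1 using neg d by (intro sum_pos) auto
  have im0: "Im (\<Sum>i<n. r i) = 0"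
    using real unfolding c1 by simp
  have "2 * Re (coeff p (n - 2)) = Re (2 * coeff p (n - 2))" by simp
  also have "\<dots> = (\<Sum>i<n. Re (r i))\<^sup>2 - (\<Sum>i<n. (Re (r i))\<^sup>2 - (Im (r i))\<^sup>2)"
    unfolding c2 using im0 by (simp add: Re_power2)
  finally have e2: "2 * Re (coeff p (n - 2))
      = (Re (coeff p (n - 1)))\<^sup>2 - (\<Sum>i<n. (Re (r i))\<^sup>2) + (\<Sum>i<n. (Im (r i))\<^sup>2)"
    unfolding e1 by (simp add: sum_negf sum_subtractf)
  have sq: "(\<Sum>i<n. (Re (r i))\<^sup>2) \<le> (Re (coeff p (n - 1)))\<^sup>2"
  proof -
    have "(\<Sum>i<n. (Re (r i))\<^sup>2) \<le> (\<Sum>i<n. - Re (r i) * (\<Sum>j<n. - Re (r j)))"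
    proof (rule sum_mono)
      fix i assume i: "i \<in> {..<n}"
      have "- Re (r i) \<le> (\<Sum>j<n. - Re (r j))"
        using neg i by (intro member_le_sum) (auto simp: less_imp_le)
      then have "- Re (r i) * - Re (r i) \<le> - Re (r i) * (\<Sum>j<n. - Re (r j))"
        using neg[of i] i by (intro mult_left_mono) auto
      then show "(Re (r i))\<^sup>2 \<le> - Re (r i) * (\<Sum>j<n. - Re (r j))"
        by (simp add: power2_eq_square)
    qed
    also have "\<dots> = (Re (coeff p (n - 1)))\<^sup>2"
      unfolding e1 power2_eq_square sum_distrib_right ..
    finally show ?thesis .
  qed
  have root_bound: "(cmod (r i))\<^sup>2 \<le> R" if "i < n" for i
  proof -
    have "(Re (r i))\<^sup>2 \<le> (\<Sum>i<n. (Re (r i))\<^sup>2)" "(Im (r i))\<^sup>2 \<le> (\<Sum>i<n. (Im (r i))\<^sup>2)"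
      using that by (auto intro!: member_le_sum)
    then show ?thesis
      using sq e2 unfolding cmod_power2 R_def by linarith
  qed
  have "coeff p 0 = (\<Prod>i<n. - r i)"
    by (simp add: poly_0_coeff_0[symmetric] p poly_prod)
  then have "(cmod (coeff p 0))\<^sup>2 = (\<Prod>i<n. (cmod (r i))\<^sup>2)"
    by (simp add: prod_norm[symmetric] prod_power_distrib)
  also have "\<dots> \<le> (\<Prod>i<n. R)"
    using root_bound by (intro prod_mono) auto
  finally show "(cmod (coeff p 0))\<^sup>2 \<le> R ^ n" by simp
qed

text \<open>For small \<open>c > 0\<close> the coefficient bound above fails, its left side being of order \<open>c\<^sup>2\<close> and
  its right side of order at most \<open>c ^ n\<close>. Nonpositive \<open>c\<close> is covered because a monic polynomial
  with all roots in the open left half-plane has a positive subleading coefficient \<open>c * a (n - 1)\<close>. A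
  singular grounded Laplacian, as of a disconnected graph, is therefore no special case.\<close>

lemma unstable_root_for_small_gain:
  fixes a :: "nat \<Rightarrow> real"
  assumes n: "n \<ge> 3" and a: "\<And>k. k < n \<Longrightarrow> a k > 0"
  obtains \<delta> where "\<delta> > 0"
    and "\<And>c. c < \<delta> \<Longrightarrow>
      \<exists>s. Re s \<ge> 0 \<and> s ^ n + of_real c * (\<Sum>k<n. of_real (a k) * s ^ k) = 0"
proof -
  \<comment> \<open>For \<open>0 < c < 1\<close> the bound \<open>R\<close> on the squared moduli of the roots is at most \<open>c * K\<close>, so
    it would force \<open>c\<^sup>2 * (a 0)\<^sup>2 \<le> (c * K) ^ n \<le> c\<^sup>3 * K ^ n\<close>; the second argument of \<open>min\<close> is
    where the two outer terms are equal.\<close>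
  define K where "K = (a (n - 1))\<^sup>2 + 2 * a (n - 2)"
  define \<delta> where "\<delta> = min 1 ((a 0)\<^sup>2 / K ^ n)"
  have K: "K > 0" using a[of "n - 2"] n by (auto simp: K_def intro!: add_nonneg_pos)
  have \<delta>: "\<delta> > 0" using a[of 0] n K by (auto simp: \<delta>_def)
  have "\<exists>s. Re s \<ge> 0 \<and> s ^ n + of_real c * (\<Sum>k<n. of_real (a k) * s ^ k) = 0"
    if c: "c < \<delta>" for c
  proof (rule ccontr)
    assume no: "\<not> ?thesis"
    define q where "q = (\<Sum>k<n. monom (complex_of_real (c * a k)) k)"
    define p where "p = monom 1 n + q"
    have poly_p: "poly p s = s ^ n + of_real c * (\<Sum>k<n. of_real (a k) * s ^ k)" for s
      by (simp add: p_def q_def poly_monom poly_sum sum_distrib_left mult.assoc)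
    have coeff_q: "coeff q k = (if k < n then of_real (c * a k) else 0)" for k
      by (simp add: q_def coeff_sum if_distrib[of "\<lambda>x. x = _"] sum.delta' cong: if_cong)
    have coeff_p: "coeff p k = of_real (c * a k)" if "k < n" for k
      using that by (simp add: p_def coeff_q)
    have "degree q < n" using n by (intro degree_lessI) (auto simp: coeff_q)
    then have deg: "degree p = n" by (simp add: p_def degree_add_eq_left degree_monom_eq)
    have monic: "lead_coeff p = 1" unfolding deg by (simp add: p_def coeff_q)
    have hurwitz: "Re s < 0" if "poly p s = 0" for s
      using no that by (auto simp: poly_p not_le)
    have n1: "n - 1 < n" "n - 2 < n" "0 < n" and n2: "n \<ge> 2" using n by auto
    have "0 < c * a (n - 1)"
      using hurwitz_subleading_pos[OF deg n2 monic hurwitz] n1 by (simp add: coeff_p)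
    then have c0: "c > 0" using a[OF n1(1)] by (simp add: zero_less_mult_iff)
    have c1: "c < 1" using c by (simp add: \<delta>_def)
    have "(c * a 0)\<^sup>2 \<le> ((c * a (n - 1))\<^sup>2 + 2 * (c * a (n - 2))) ^ n"
      using hurwitz_constant_coeff_bound[OF deg n2 monic hurwitz] n1 by (simp add: coeff_p norm_mult power_mult_distrib)
    also have "\<dots> \<le> (c * K) ^ n"
    proof (rule power_mono)
      have "c * c * (a (n - 1))\<^sup>2 \<le> c * 1 * (a (n - 1))\<^sup>2"
        using c0 c1 by (intro mult_right_mono mult_left_mono) auto
      then show "(c * a (n - 1))\<^sup>2 + 2 * (c * a (n - 2)) \<le> c * K"
        by (simp add: K_def power2_eq_square algebra_simps)
      show "0 \<le> (c * a (n - 1))\<^sup>2 + 2 * (c * a (n - 2))"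
        using c0 a[OF n1(2)] by (auto intro!: add_nonneg_nonneg)
    qed
    also have "\<dots> \<le> c ^ 3 * K ^ n"
      unfolding power_mult_distrib using c0 c1 n K
      by (intro mult_right_mono power_decreasing) auto
    finally have "c\<^sup>2 * (a 0)\<^sup>2 \<le> c\<^sup>2 * (c * K ^ n)"
      by (simp add: power_mult_distrib power2_eq_square power3_eq_cube ac_simps)
    then have "(a 0)\<^sup>2 \<le> c * K ^ n" using c0 by simp
    moreover have "c * K ^ n < (a 0)\<^sup>2"
      using c K by (simp add: \<delta>_def field_simps)
    ultimately show False by simp
  qed
  with \<delta> show ?thesis using that by blast
qed

section \<open>The smallest eigenvalue of a symmetric matrix\<close>

text \<open>Vectors are functions on \<open>nat\<close> vanishing from \<open>m\<close> on, since the dimension \<open>m\<close> varies with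
  the graph. The sphere is closed in a product of compact intervals, hence compact by
  Tychonoff's theorem.\<close>

lemma compact_unit_sphere_functions:
  "compact {x :: nat \<Rightarrow> real. (\<forall>i\<ge>m. x i = 0) \<and> (\<Sum>i<m. (x i)\<^sup>2) = 1}" (is "compact ?S")
proof -
  let ?B = "PiE UNIV (\<lambda>i. if i < m then {-1..1::real} else {0})"
  have "compactin (product_topology (\<lambda>i. euclidean) UNIV) ?B"
    unfolding compactin_PiE by auto
  then have B: "compact ?B"
    by (simp only: euclidean_product_topology compactin_euclidean_iff)
  have coord: "continuous_on UNIV (\<lambda>x :: nat \<Rightarrow> real. x i)" for i by simp
  have "?S = (\<Inter>i\<in>{m..}. {x. x i = 0}) \<inter> {x. (\<Sum>i<m. (x i)\<^sup>2) = 1}" by auto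
  also have "closed \<dots>"
    by (intro closed_Int closed_INT ballI closed_Collect_eq continuous_intros coord)
  finally have "closed ?S" .
  with B have compact: "compact (?B \<inter> ?S)" by (rule compact_Int_closed)
  have subset: "?S \<subseteq> ?B"
  proof
    fix x assume x: "x \<in> ?S"
    have "\<bar>x i\<bar> \<le> 1" if "i < m" for i
    proof -
      have "(x i)\<^sup>2 \<le> (\<Sum>i<m. (x i)\<^sup>2)" using that by (intro member_le_sum) auto
      then show ?thesis using x by (simp add: abs_square_le_1)
    qed
    then show "x \<in> ?B" using x by (auto simp: abs_le_iff)
  qed
  show ?thesis using compact unfolding Int_absorb1[OF subset] .
qed

lemma nonneg_quadratic_imp_linear_coeff_zero:
  fixes b c :: real
  assumes "\<And>t. 0 \<le> 2 * t * b + t\<^sup>2 * c"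
  shows "b = 0"
proof (rule ccontr)
  assume b: "b \<noteq> 0"
  \<comment> \<open>At \<open>t = - b / d\<close> the linear term dominates; the absolute value and \<open>+ 1\<close> make \<open>d\<close>
    positive and larger than \<open>c / 2\<close>.\<close>
  define d where "d = \<bar>c\<bar> + 1"
  have d: "d > 0" "c < 2 * d" by (auto simp: d_def)
  have "2 * (- b / d) * b + (- b / d)\<^sup>2 * c = b\<^sup>2 / d\<^sup>2 * (c - 2 * d)"
    using d by (simp add: field_simps power2_eq_square)
  also have "\<dots> < 0" using b d by (intro mult_pos_neg) auto
  finally show False using assms[of "- b / d"] by simp
qed

text \<open>The quadratic form attains its minimum \<open>\<mu>\<close> over the unit sphere at some \<open>v\<close>. Then
  \<open>x\<^sup>T (A - \<mu>) x\<close> is nonnegative everywhere and vanishes at \<open>v\<close>, so its first variation at \<open>v\<close>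
  in each coordinate direction is zero, which says \<open>A v = \<mu> v\<close>.\<close>

lemma symmetric_matrix_min_eigenpair:
  fixes A :: "nat \<Rightarrow> nat \<Rightarrow> real"
  assumes m: "m > 0" and sym: "\<forall>i<m. \<forall>j<m. A i j = A j i"
  obtains v \<mu> where "\<exists>i<m. v i \<noteq> 0"
    and "\<forall>i<m. (\<Sum>j<m. A i j * v j) = \<mu> * v i"
    and "\<forall>x. \<mu> * (\<Sum>i<m. (x i)\<^sup>2) \<le> (\<Sum>i<m. \<Sum>j<m. x i * A i j * x j)"
proof -
  define S where "S = {x :: nat \<Rightarrow> real. (\<forall>i\<ge>m. x i = 0) \<and> (\<Sum>i<m. (x i)\<^sup>2) = 1}"
  define Q where "Q x = (\<Sum>i<m. \<Sum>j<m. x i * A i j * x j)" for x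
  have coord: "continuous_on S (\<lambda>x :: nat \<Rightarrow> real. x i)" for i
    by (rule continuous_on_subset[OF continuous_on_product_coordinates]) simp
  have "continuous_on S Q" unfolding Q_def
    by (intro continuous_intros coord)
  moreover have "(\<lambda>i. if i = 0 then 1 else 0) \<in> S"
    using m by (auto simp: S_def if_distrib[of "\<lambda>x. x\<^sup>2"] sum.delta cong: if_cong)
  moreover have "compact S" unfolding S_def by (rule compact_unit_sphere_functions)
  ultimately obtain v where v: "v \<in> S" and min: "\<And>x. x \<in> S \<Longrightarrow> Q v \<le> Q x"
    using continuous_attains_inf[of S Q] by blast
  have rayleigh: "Q v * (\<Sum>i<m. (x i)\<^sup>2) \<le> Q x" for x
  proof (cases "(\<Sum>i<m. (x i)\<^sup>2) = 0")
    case True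
    then have "\<forall>i<m. x i = 0" by (simp add: sum_nonneg_eq_0_iff)
    then show ?thesis using True by (simp add: Q_def)
  next
    case False
    define s where "s = (\<Sum>i<m. (x i)\<^sup>2)"
    have s: "s > 0" using False by (simp add: s_def less_le sum_nonneg)
    define y where "y i = (if i < m then x i / sqrt s else 0)" for i
    have "(\<Sum>i<m. (y i)\<^sup>2) = s / s"
      using s by (simp add: y_def power_divide sum_divide_distrib[symmetric] s_def)
    then have "y \<in> S" using s by (simp add: S_def y_def)
    then have "Q v \<le> Q y" by (rule min)
    also have "Q y = Q x / s"
      using s by (simp add: Q_def y_def sum_divide_distrib)
    finally show ?thesis using s by (simp add: field_simps s_def)
  qed
  have eigen: "(\<Sum>j<m. A i j * v j) = Q v * v i" if i: "i < m" for i
  proof -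
    have "0 \<le> 2 * t * ((\<Sum>j<m. A i j * v j) - Q v * v i) + t\<^sup>2 * (A i i - Q v)" for t
    proof -
      define e where "e k = (if k = i then t else 0)" for k :: nat
      have e: "(\<Sum>k<m. f k * e k) = f i * t" "(\<Sum>k<m. e k * f k) = t * f i" for f
        using i by (auto simp: e_def if_distrib[of "\<lambda>x. _ * x"] if_distrib[of "\<lambda>x. x * _"] sum.delta
            cong: if_cong)
      have "(\<Sum>k<m. (v k + e k)\<^sup>2) = (\<Sum>k<m. (v k)\<^sup>2) + 2 * (\<Sum>k<m. v k * e k) + (\<Sum>k<m. e k * e k)"
        by (simp add: power2_eq_square algebra_simps sum.distrib sum_distrib_left)
      also have "\<dots> = 1 + 2 * t * v i + t\<^sup>2"
        using v by (simp add: e) (simp add: S_def e_def power2_eq_square)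
      finally have norm: "(\<Sum>k<m. (v k + e k)\<^sup>2) = 1 + 2 * t * v i + t\<^sup>2" .
      have "Q (\<lambda>k. v k + e k) = Q v + (\<Sum>k<m. \<Sum>j<m. e k * (A k j * v j))
          + (\<Sum>k<m. \<Sum>j<m. v k * A k j * e j) + (\<Sum>k<m. \<Sum>j<m. e k * A k j * e j)"
        by (simp add: Q_def algebra_simps sum.distrib)
      also have "(\<Sum>k<m. \<Sum>j<m. e k * (A k j * v j)) = t * (\<Sum>j<m. A i j * v j)"
        by (simp add: sum_distrib_left[symmetric] e)
      also have "(\<Sum>k<m. \<Sum>j<m. v k * A k j * e j) = t * (\<Sum>j<m. A i j * v j)"
        using i by (simp add: e sum_distrib_left) (intro sum.cong, auto simp: sym)
      also have "(\<Sum>k<m. \<Sum>j<m. e k * A k j * e j) = t\<^sup>2 * A i i"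
        by (simp add: e) (simp add: mult.assoc e power2_eq_square)
      finally have "Q (\<lambda>k. v k + e k) = Q v + 2 * t * (\<Sum>j<m. A i j * v j) + t\<^sup>2 * A i i" by simp
      with rayleigh[of "\<lambda>k. v k + e k"] norm show ?thesis
        by (simp add: algebra_simps)
    qed
    then have "(\<Sum>j<m. A i j * v j) - Q v * v i = 0"
      by (rule nonneg_quadratic_imp_linear_coeff_zero)
    then show ?thesis by simp
  qed
  have nonzero: "\<exists>i<m. v i \<noteq> 0"
  proof (rule ccontr)
    assume "\<not> ?thesis"
    then have "(\<Sum>i<m. (v i)\<^sup>2) = 0" by simp
    with v show False by (simp add: S_def)
  qed
  show ?thesis
  proof (rule that[OF nonzero])
    show "\<forall>i<m. (\<Sum>j<m. A i j * v j) = Q v * v i" using eigen by blast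
    show "\<forall>x. Q v * (\<Sum>i<m. (x i)\<^sup>2) \<le> (\<Sum>i<m. \<Sum>j<m. x i * A i j * x j)"
    proof
      fix x
      show "Q v * (\<Sum>i<m. (x i)\<^sup>2) \<le> (\<Sum>i<m. \<Sum>j<m. x i * A i j * x j)"
        using rayleigh[of x] unfolding Q_def[of x] .
    qed
  qed
qed

section \<open>The grounded Laplacian\<close>

lemma laplacian_entry:
  assumes G: "is_weighted_graph G" and "i < num_nodes G" "j < num_nodes G"
  shows "laplacian G $$ (i, j)
    = (if i = j then \<Sum>k<num_nodes G. weight G i k else 0) - weight G i j"
proof -
  have "(\<Sum>k\<in>neighbors G i. weight G i k) = (\<Sum>k<num_nodes G. weight G i k)"
    using G by (intro sum.mono_neutral_left) (auto simp: neighbors_def is_weighted_graph_def)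
  then show ?thesis
    using assms by (auto simp: laplacian_def neighbors_def is_weighted_graph_def)
qed

lemma grounded_laplacian_entry:
  assumes G: "is_weighted_graph G" and "i < num_nodes G - 1" "j < num_nodes G - 1"
  shows "grounded_laplacian G $$ (i, j)
    = (if i = j then \<Sum>k<num_nodes G. weight G (Suc i) k else 0) - weight G (Suc i) (Suc j)"
proof -
  have "dim_row (laplacian G) = num_nodes G" "dim_col (laplacian G) = num_nodes G"
    by (simp_all add: laplacian_def)
  then have "grounded_laplacian G $$ (i, j) = laplacian G $$ (Suc i, Suc j)"
    using assms by (simp add: grounded_laplacian_def mat_delete_def)
  then show ?thesis using assms by (simp add: laplacian_entry)
qed

lemma weight_symmetric:
  assumes "is_weighted_graph G" "undirected G"
  shows "weight G i j = weight G j i"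
  using assms unfolding is_weighted_graph_def undirected_def by metis

text \<open>A row of the full Laplacian sums to zero, so deleting the leader's column leaves the row sum
  equal to the weight of the edge to the leader. The absolute value allows for a graph without
  edges, where \<open>w_max\<close> may be negative.\<close>

lemma grounded_laplacian_sum_le_leader_degree:
  assumes G: "is_weighted_graph G" and und: "undirected G"
    and deg: "card (neighbors G 0) \<le> q"
    and w: "\<And>i j. (i, j) \<in> edges G \<Longrightarrow> weight G i j \<le> w_max"
  defines "m \<equiv> num_nodes G - 1"
  shows "(\<Sum>i<m. \<Sum>j<m. grounded_laplacian G $$ (i, j)) \<le> q * \<bar>w_max\<bar>"
proof -
  have N: "num_nodes G = Suc m" using G by (simp add: m_def is_weighted_graph_def)
  have row: "(\<Sum>j<m. grounded_laplacian G $$ (i, j)) = weight G 0 (Suc i)" if "i < m" for i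
  proof -
    have "(\<Sum>j<m. grounded_laplacian G $$ (i, j))
        = (\<Sum>k<Suc m. weight G (Suc i) k) - (\<Sum>j<m. weight G (Suc i) (Suc j))"
      using that by (simp add: grounded_laplacian_entry[OF G] N sum_subtractf sum.delta' del: sum.lessThan_Suc)
    also have "\<dots> = weight G (Suc i) 0"
      by (simp only: sum.lessThan_Suc_shift)
    finally show ?thesis using weight_symmetric[OF G und] by simp
  qed
  have "(\<Sum>i<m. \<Sum>j<m. grounded_laplacian G $$ (i, j)) = (\<Sum>i<m. weight G 0 (Suc i))"
    by (simp add: row)
  also have "\<dots> \<le> (\<Sum>k<num_nodes G. weight G 0 k)"
  proof -
    have "0 \<le> weight G 0 0" using G by (simp add: is_weighted_graph_def)
    then show ?thesis unfolding N by (simp only: sum.lessThan_Suc_shift)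
  qed
  also have "\<dots> = (\<Sum>k\<in>neighbors G 0. weight G 0 k)"
    using G by (intro sum.mono_neutral_right) (auto simp: neighbors_def is_weighted_graph_def)
  also have "\<dots> \<le> card (neighbors G 0) * \<bar>w_max\<bar>"
    using w by (intro sum_bounded_above) (force simp: neighbors_def)
  also have "\<dots> \<le> q * \<bar>w_max\<bar>"
    using deg by (intro mult_right_mono) auto
  finally show ?thesis .
qed

section \<open>Modal solutions of the closed loop\<close>

lemma sum_blocks:
  fixes f :: "nat \<Rightarrow> nat \<Rightarrow> 'a :: comm_monoid_add"
  assumes "m > 0"
  shows "(\<Sum>c<n * m. f (c div m) (c mod m)) = (\<Sum>k<n. \<Sum>j<m. f k j)"
proof -
  have "(\<Sum>c<n * m. f (c div m) (c mod m)) = (\<Sum>k<n. \<Sum>c=k * m..<k * m + m. f (c div m) (c mod m))"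
    by (rule sum.nat_group[symmetric])
  also have "\<dots> = (\<Sum>k<n. \<Sum>j<m. f k j)"
  proof (rule sum.cong[OF refl])
    fix k
    have "(\<Sum>c=k * m..<k * m + m. f (c div m) (c mod m)) = (\<Sum>j=0..<m. f ((j + k * m) div m) ((j + k * m) mod m))"
      using sum.shift_bounds_nat_ivl[of "\<lambda>c. f (c div m) (c mod m)" 0 "k * m" m]
      by (simp add: add.commute)
    also have "\<dots> = (\<Sum>j<m. f k j)"
      using assms by (intro sum.cong) auto
    finally show "(\<Sum>c=k * m..<k * m + m. f (c div m) (c mod m)) = (\<Sum>j<m. f k j)" .
  qed
  finally show ?thesis .
qed

text \<open>The modal solution is \<open>x\<^sub>i(t) = Re (e\<^sup>s\<^sup>t) v\<^sub>i\<close>, whose \<open>k\<close>-th derivative is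
  \<open>Re (s\<^sup>k e\<^sup>s\<^sup>t) v\<^sub>i\<close>. The upper blocks of the system hold by differentiation, and the last block
  says that the \<open>n\<close>-th derivative agrees with \<open>- \<mu> \<Sum> a\<^sub>k Re (s\<^sup>k e\<^sup>s\<^sup>t) v\<^sub>i\<close>, which is the
  root equation.\<close>

lemma modal_closed_loop_solution:
  fixes s :: complex and v :: "nat \<Rightarrow> real"
  assumes n: "n > 0" and m: "m = num_nodes G - 1" "m > 0"
    and eig: "\<And>i. i < m \<Longrightarrow> (\<Sum>j<m. grounded_laplacian G $$ (i, j) * v j) = \<mu> * v i"
    and root: "s ^ n + of_real \<mu> * (\<Sum>k<n. of_real (a k) * s ^ k) = 0"
  shows "closed_loop_solution n a G
    (\<lambda>t. vec (n * m) (\<lambda>r. Re (s ^ (r div m) * exp (s * of_real t)) * v (r mod m)))"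
    (is "closed_loop_solution n a G ?\<xi>")
proof -
  let ?M = "closed_loop_matrix n a G" and ?L = "grounded_laplacian G"
  let ?g = "\<lambda>k t. Re (s ^ k * exp (s * of_real t))"
  have deriv: "(?g k has_real_derivative ?g (Suc k) t) (at t within T)" for k t T
  proof -
    have "((\<lambda>z. s ^ k * exp (s * z)) has_field_derivative s ^ Suc k * exp (s * of_real t)) (at (of_real t))"
      by (auto intro!: derivative_eq_intros)
    from has_field_derivative_Re[OF has_vector_derivative_real_field[OF this]]
    show ?thesis .
  qed
  have step: "(?M *\<^sub>v ?\<xi> t) $ r = ?g (Suc (r div m)) t * v (r mod m)" if r: "r < n * m" for r t
  proof -
    have i: "r mod m < m" and k: "r div m < n"
      using m r by (auto simp: less_mult_imp_div_less)
    have M: "?M $$ (r, c) = (if r div m < n - 1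
           then (if c div m = r div m + 1 then if c mod m = r mod m then 1 else 0 else 0)
           else - a (c div m) * ?L $$ (r mod m, c mod m))" if "c < n * m" for c
      using r that i m by (auto simp: closed_loop_matrix_def Let_def m(1)[symmetric])
    have "dim_row ?M = n * m" "dim_col ?M = n * m"
      by (simp_all add: closed_loop_matrix_def Let_def m)
    then have "(?M *\<^sub>v ?\<xi> t) $ r = (\<Sum>c<n * m. ?M $$ (r, c) * (?g (c div m) t * v (c mod m)))"
      using r by (simp add: scalar_prod_def atLeast0LessThan)
    also have "\<dots> = ?g (Suc (r div m)) t * v (r mod m)"
    proof (cases "r div m < n - 1")
      case True
      have "(\<Sum>c<n * m. ?M $$ (r, c) * (?g (c div m) t * v (c mod m)))
          = (\<Sum>c<n * m. (\<lambda>k j. if k = Suc (r div m) then if j = r mod m then ?g k t * v j else 0 else 0) (c div m) (c mod m))"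
        using True by (intro sum.cong) (auto simp: M)
      also have "\<dots> = (\<Sum>k<n. \<Sum>j<m. if k = Suc (r div m) then if j = r mod m then ?g k t * v j else 0 else 0)"
        using m by (intro sum_blocks)
      also have "\<dots> = (\<Sum>k<n. if k = Suc (r div m) then ?g k t * v (r mod m) else 0)"
        using i by (intro sum.cong) (auto simp: sum.delta)
      also have "\<dots> = ?g (Suc (r div m)) t * v (r mod m)"
        using True by (subst sum.delta) auto
      finally show ?thesis .
    next
      case False
      with k n have last: "Suc (r div m) = n" by auto
      have "(\<Sum>c<n * m. ?M $$ (r, c) * (?g (c div m) t * v (c mod m)))
          = (\<Sum>c<n * m. (\<lambda>k j. - (a k * ?g k t) * (?L $$ (r mod m, j) * v j)) (c div m) (c mod m))"
        using False by (intro sum.cong) (auto simp: M)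
      also have "\<dots> = (\<Sum>k<n. \<Sum>j<m. - (a k * ?g k t) * (?L $$ (r mod m, j) * v j))"
        using m by (intro sum_blocks)
      also have "\<dots> = (\<Sum>k<n. - (a k * ?g k t) * (\<mu> * v (r mod m)))"
        by (simp only: sum_distrib_left[symmetric] eig[OF i])
      also have "\<dots> = Re (- of_real \<mu> * (\<Sum>k<n. of_real (a k) * s ^ k) * exp (s * of_real t)) * v (r mod m)"
        by (simp add: sum_distrib_left sum_distrib_right mult.assoc Re_sum sum_negf)
           (simp add: algebra_simps sum_distrib_left sum_distrib_right sum_subtractf sum.distrib)
      also have "- of_real \<mu> * (\<Sum>k<n. of_real (a k) * s ^ k) = s ^ n"
        using root by (simp add: add_eq_0_iff)
      finally show ?thesis by (simp add: last)
    qed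
    finally show ?thesis .
  qed
  show ?thesis
    unfolding closed_loop_solution_def m(1)[symmetric]
  proof (intro allI impI conjI)
    fix t :: real
    show "?\<xi> t \<in> carrier_vec (n * m)" by simp
    fix r assume r: "r < n * m"
    have coord: "(\<lambda>u. ?\<xi> u $ r) = (\<lambda>u. ?g (r div m) u * v (r mod m))" using r by simp
    show "((\<lambda>u. ?\<xi> u $ r) has_real_derivative (?M *\<^sub>v ?\<xi> t) $ r) (at t within {0..})"
      unfolding step[OF r] coord by (intro DERIV_cmult_right deriv)
  qed
qed

text \<open>Since \<open>e\<^bsup>Re s t\<^esup> \<ge> 1\<close> for \<open>t \<ge> 0\<close>, a vanishing limit would give \<open>cos (\<omega> t) \<longlongrightarrow> 0\<close>
  with \<open>\<omega> = Im s\<close>. The double angle formula \<open>cos (2 \<omega> t) = 2 cos\<^sup>2 (\<omega> t) - 1\<close> excludes this,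
  for \<open>\<omega> = 0\<close> as well.\<close>

lemma Re_exp_not_tendsto_0:
  assumes "Re s \<ge> 0" and "c \<noteq> 0"
  shows "\<not> ((\<lambda>t. Re (exp (s * of_real t)) * c) \<longlongrightarrow> 0) at_top"
proof
  assume "((\<lambda>t. Re (exp (s * of_real t)) * c) \<longlongrightarrow> 0) at_top"
  then have lim: "((\<lambda>t. exp (Re s * t) * cos (Im s * t)) \<longlongrightarrow> 0) at_top"
    using assms(2) tendsto_mult_right_iff[of c "\<lambda>t. Re (exp (s * of_real t))" 0 at_top]
    by (simp add: Re_exp)
  have cos0: "((\<lambda>t. cos (Im s * t)) \<longlongrightarrow> 0) at_top"
  proof (rule tendsto_0_le[OF lim])
    show "\<forall>\<^sub>F t in at_top. norm (cos (Im s * t)) \<le> norm (exp (Re s * t) * cos (Im s * t)) * 1"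
      using eventually_ge_at_top[of 0]
    proof eventually_elim
      case (elim t)
      have "1 * \<bar>cos (Im s * t)\<bar> \<le> exp (Re s * t) * \<bar>cos (Im s * t)\<bar>"
        using assms elim by (intro mult_right_mono) auto
      then show ?case by (simp add: abs_mult)
    qed
  qed
  have "filterlim (\<lambda>t::real. 2 * t) at_top at_top"
    by (rule filterlim_tendsto_pos_mult_at_top[OF tendsto_const _ filterlim_ident]) simp
  from filterlim_compose[OF cos0 this]
  have "((\<lambda>t. cos (2 * (Im s * t))) \<longlongrightarrow> 0) at_top" by (simp add: mult.left_commute)
  moreover have "((\<lambda>t. cos (2 * (Im s * t))) \<longlongrightarrow> 2 * 0\<^sup>2 - 1) at_top"
    unfolding cos_double_cos by (intro tendsto_intros cos0)
  ultimately have "(0::real) = 2 * 0\<^sup>2 - 1"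
    by (intro tendsto_unique[OF trivial_limit_at_top_linorder])
  then show False by simp
qed

lemma no_consensus_if_unstable_mode:
  fixes s :: complex and v :: "nat \<Rightarrow> real"
  assumes n: "n > 0" and m: "m = num_nodes G - 1" 
    and eig: "\<And>i. i < m \<Longrightarrow> (\<Sum>j<m. grounded_laplacian G $$ (i, j) * v j) = \<mu> * v i"
    and v: "i < m" "v i \<noteq> 0"
    and s: "Re s \<ge> 0" "s ^ n + of_real \<mu> * (\<Sum>k<n. of_real (a k) * s ^ k) = 0"
  shows "\<not> achieves_consensus n a G"
proof
  assume cons: "achieves_consensus n a G"
  let ?\<xi> = "\<lambda>t. vec (n * m) (\<lambda>r. Re (s ^ (r div m) * exp (s * of_real t)) * v (r mod m))"
  have sol: "closed_loop_solution n a G ?\<xi>"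
    using n m v eig s(2) by (intro modal_closed_loop_solution) auto
  have "i < n * m" using n v(1) by (metis less_le_trans mult_le_mono1 nat_mult_1 Suc_leI One_nat_def)
  then have state: "agent_state G ?\<xi> 0 (Suc i) t - agent_state G ?\<xi> 0 0 t = Re (exp (s * of_real t)) * v i" for t
    using v by (simp add: agent_state_def)
  have "((\<lambda>t. agent_state G ?\<xi> 0 (Suc i) t - agent_state G ?\<xi> 0 0 t) \<longlongrightarrow> 0) at_top"
    using cons[unfolded achieves_consensus_def, rule_format, OF sol, of "Suc i" 0 0] n m v
    by auto
  with Re_exp_not_tendsto_0[OF s(1) v(2)] show False unfolding state by blast
qed

section \<open>No scalable stability from order three on\<close>

theorem theorem3p3:
  fixes n q :: nat and w_max :: real
    and \<G> :: "nat \<Rightarrow> weighted_graph"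
    and a :: "nat \<Rightarrow> real"
  assumes "n \<ge> 3"
    and "graph_family \<G>"
    and "\<And>m. undirected (\<G> m)"
    and "\<And>m i. i < num_nodes (\<G> m) \<Longrightarrow> card (neighbors (\<G> m) i) \<le> q"
    and "\<And>m i j. (i, j) \<in> edges (\<G> m) \<Longrightarrow> weight (\<G> m) i j \<le> w_max"
    and "\<And>k. k < n \<Longrightarrow> a k > 0"
  shows "\<not> scalably_stable n a \<G>"
proof -
  obtain \<delta> where \<delta>: "\<delta> > 0" and unstable: "\<And>c. c < \<delta> \<Longrightarrow>
      \<exists>s. Re s \<ge> 0 \<and> s ^ n + of_real c * (\<Sum>k<n. of_real (a k) * s ^ k) = 0"
    using unstable_root_for_small_gain[of n a] assms(1,6) by blast
  \<comment> \<open>Followers needed for the Rayleigh quotient at the all-ones vector to fall below \<open>\<delta>\<close>; the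
    graph with index \<open>l + 2\<close> has at least \<open>l + 2\<close> nodes, so at least \<open>l + 1\<close> followers.\<close>
  obtain l :: nat where l: "q * \<bar>w_max\<bar> / \<delta> < l" using reals_Archimedean2 by blast
  define G where "G = \<G> (Suc (Suc l))"
  define m where "m = num_nodes G - 1"
  let ?L = "grounded_laplacian G"
  have G: "is_weighted_graph G" and und: "undirected G"
    using assms(2,3) by (auto simp: G_def graph_family_def)
  have "Suc (Suc l) \<le> num_nodes G"
    using assms(2) strict_mono_imp_increasing[of "\<lambda>m. num_nodes (\<G> m)" "Suc (Suc l)"]
    by (auto simp: G_def graph_family_def)
  then have m: "m > 0" "l \<le> m" by (auto simp: m_def)
  have L_sym: "\<forall>i<m. \<forall>j<m. ?L $$ (i, j) = ?L $$ (j, i)"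
    using weight_symmetric[OF G und] by (simp add: m_def grounded_laplacian_entry[OF G])
  obtain v \<mu> where v: "\<exists>i<m. v i \<noteq> 0"
    and eig: "\<forall>i<m. (\<Sum>j<m. ?L $$ (i, j) * v j) = \<mu> * v i"
    and rayleigh: "\<forall>x. \<mu> * (\<Sum>i<m. (x i)\<^sup>2) \<le> (\<Sum>i<m. \<Sum>j<m. x i * ?L $$ (i, j) * x j)"
    by (rule symmetric_matrix_min_eigenpair[of m "\<lambda>i j. ?L $$ (i, j)", OF m(1) L_sym])
  have "\<mu> * m \<le> (\<Sum>i<m. \<Sum>j<m. ?L $$ (i, j))"
    using spec[OF rayleigh, of "\<lambda>i. 1"] by simp
  also have "\<dots> \<le> q * \<bar>w_max\<bar>"
    unfolding m_def using assms(4)[of 0] assms(5) m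
    by (intro grounded_laplacian_sum_le_leader_degree[OF G und]) (auto simp: G_def m_def)
  also have "\<dots> < \<delta> * m"
  proof -
    have "q * \<bar>w_max\<bar> / \<delta> < m" using l m(2) by linarith
    then show ?thesis using \<delta> by (simp add: pos_divide_less_eq mult.commute)
  qed
  finally have "\<mu> < \<delta>" using m by simp
  then obtain s where s: "Re s \<ge> 0" "s ^ n + of_real \<mu> * (\<Sum>k<n. of_real (a k) * s ^ k) = 0"
    using unstable by blast
  obtain i where i: "i < m" "v i \<noteq> 0" using v by blast
  have "\<not> achieves_consensus n a G"
    by (rule no_consensus_if_unstable_mode[OF _ m_def eig[rule_format] i s]) (use assms(1) in simp_all)
  then show ?thesis unfolding scalably_stable_def G_def by blast
qed

end
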